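(* Let $Y$ be a $1$-homogeneous metric space with exactly two isosceles-generated components $X, X'$. Then $Y$ is isometric to a rainbow duplicate of $X$. More precisely, the following hold. (1) $\{d(x,x'):x\in X,\ x'\in X'\}=\operatorname{Dist}(Y)\setminus\operatorname{Dist}(X)$, and for every $q$ in this set there is a unique map $f_q\colon Y\to Y$ such that $d(y,f_q(y))=q$ for all $y\in Y$. We have $f_q\circ f_q=\mathrm{id}_Y$, $f_q$ swaps the components $X,X'$, the restriction $f_q\colon X\to X'$ is an isometry, and $f_q\circ g=g\circ f_q$ for every $g\in\operatorname{Aut}(Y)$. Fix such a $q$. (2) The map $\phi\colon\langle x,i\rangle\mapsto f_q^i(x)$ is a bijection $X\times\{0,1\}\to Y$ such that the metric $d$ on $X\times 2:=X\times\{0,1\}$ turning $\phi$ into an isometry satisfies $d(\langle x,i\rangle,\langle y,i\rangle)=d_X(x,y)$ for all $x,y\in X$ and $i\in\{0,1\}$. (3) Let $H:=\{h|_X:h\in\operatorname{Aut}_*(Y)\}\le\operatorname{Aut}(X)$. Then $h\mapsto h\times\mathrm{id}$ is an isomorphism $H\to\operatorname{Aut}_*(X\times 2)$, where $\operatorname{Aut}_*(X\times 2)\cong\operatorname{Aut}_*(Y)$ via $\phi$; $H$ is Abelian; and for all $x,y\in X$ there is a unique $h\in H$ with $h(x)=y$. (4) For every $h\in H$ the distance $r(h):=d(\langle x,0\rangle,\langle h(x),1\rangle)$ does not depend on $x\in X$. This defines an injective map $r\colon H\to(0,\infty)\setminus\operatorname{Dist}(X)$. (5) The group $H$ and the map $r$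 are admissible parameters for the rainbow duplicate construction over $X$, and $\phi\colon X\times_r 2\to Y$ is an isometric isomorphism.
   Context: Isometries are bijective; $\operatorname{Aut}(X)$ is the group of all isometries $X\to X$; $\operatorname{Dist}(X)=\{d(x,y):x,y\in X\}$. A metric space is $1$-homogeneous if for all points $x,y$ there is an $F\in\operatorname{Aut}(X)$ with $F(x)=y$. For a $1$-homogeneous space $Y$, let $\sim$ be the equivalence relation on $Y$ generated by all pairs $(x,y)$ for which there is $z\in Y$, $z\neq y$, with $d(x,y)=d(x,z)$. The classes of $\sim$ are the isosceles-generated components of $Y$. $\operatorname{Aut}_*(Y)$ is the subgroup of those $f\in\operatorname{Aut}(Y)$ with $f[C]=C$ for every isosceles-generated component $C$; $\operatorname{Aut}_*(X\times 2)$ is defined likewise, the components of $X\times 2$ corresponding under $\phi$ being $X\times\{0\}$ and $X\times\{1\}$. Rainbow duplicate construction: let $X$ be a $1$-homogeneous metric space. Parameters $H$, $r$ are admissible if: $H\le\operatorname{Aut}(X)$ is an Abelian subgroup such that for all $x,y\in X$ there is a unique $h\in H$, denoted $h_x^y$, with $h(x)=y$; there exists $g\in\operatorname{Aut}(X)$ with $g\circ g=\mathrm{id}$ and $g\circ h\circ g^{-1}=h^{-1}$ for every $h\in H$; and $r\colon H\to(0,\infty)\setminus\operatorname{Dist}(X)$ is an injective map such that the following distance on $X\times\{0,1\}$ satisfies the triangle inequality: $d(\langle x,0\rangle,\langle y,0\rangle)=d(\langle x,1\rangle,\langle y,1\rangle)=d_X(x,y)$, $d(\langle x,0\rangle,\langle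 y,1\rangle)=d(\langle y,1\rangle,\langle x,0\rangle)=r(h_x^y)$. The resulting metric space is the rainbow duplicate $X\times_r 2$ of $X$. *)

theory Defs
  imports "HOL-Analysis.Abstract_Metric_Spaces" "HOL-Algebra.Bij"
begin

text \<open>A metric space is a carrier set together with a distance function (the library predicate
  \<^const>\<open>Metric_space\<close>); a subset of it carries the same distance function.\<close>

definition isometry_betw ::
  "'a set \<Rightarrow> ('a \<Rightarrow> 'a \<Rightarrow> real) \<Rightarrow> 'b set \<Rightarrow> ('b \<Rightarrow> 'b \<Rightarrow> real) \<Rightarrow> ('a \<Rightarrow> 'b) \<Rightarrow> bool"
  where "isometry_betw M d N e f \<longleftrightarrow>
    bij_betw f M N \<and> (\<forall>x\<in>M. \<forall>y\<in>M. e (f x) (f y) = d x y)"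

definition Dist :: "'a set \<Rightarrow> ('a \<Rightarrow> 'a \<Rightarrow> real) \<Rightarrow> real set"
  where "Dist M d = {d x y |x y. x \<in> M \<and> y \<in> M}"

text \<open>Self-isometries are taken extensional (\<^const>\<open>undefined\<close> off the carrier), as in
  \<^const>\<open>Bij\<close>, so that equality of group elements is equality of maps on \<open>M\<close>.\<close>

definition Aut :: "'a set \<Rightarrow> ('a \<Rightarrow> 'a \<Rightarrow> real) \<Rightarrow> ('a \<Rightarrow> 'a) set"
  where "Aut M d = {f \<in> Bij M. isometry_betw M d M d f}"

definition Aut_group :: "'a set \<Rightarrow> ('a \<Rightarrow> 'a \<Rightarrow> real) \<Rightarrow> ('a \<Rightarrow> 'a) monoid"
  where "Aut_group M d = (BijGroup M)\<lparr>carrier := Aut M d\<rparr>"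

definition one_homogeneous :: "'a set \<Rightarrow> ('a \<Rightarrow> 'a \<Rightarrow> real) \<Rightarrow> bool"
  where "one_homogeneous M d \<longleftrightarrow> (\<forall>x\<in>M. \<forall>y\<in>M. \<exists>F\<in>Aut M d. F x = y)"

definition isosceles_rel :: "'a set \<Rightarrow> ('a \<Rightarrow> 'a \<Rightarrow> real) \<Rightarrow> ('a \<times> 'a) set"
  where "isosceles_rel M d =
    equiv M hull {(x, y). x \<in> M \<and> y \<in> M \<and> (\<exists>z\<in>M. z \<noteq> y \<and> d x y = d x z)}"

definition isosceles_components :: "'a set \<Rightarrow> ('a \<Rightarrow> 'a \<Rightarrow> real) \<Rightarrow> 'a set set"
  where "isosceles_components M d = M // isosceles_rel M d"

definition Aut_star :: "'a set \<Rightarrow> ('a \<Rightarrow> 'a \<Rightarrow> real) \<Rightarrow> ('a \<Rightarrow> 'a) set"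
  where "Aut_star M d = {f \<in> Aut M d. \<forall>C\<in>isosceles_components M d. f ` C = C}"

definition Aut_star_group :: "'a set \<Rightarrow> ('a \<Rightarrow> 'a \<Rightarrow> real) \<Rightarrow> ('a \<Rightarrow> 'a) monoid"
  where "Aut_star_group M d = (Aut_group M d)\<lparr>carrier := Aut_star M d\<rparr>"

text \<open>The element \<open>h\<^sub>x\<^sup>y\<close> of a sharply transitive set \<open>H\<close> of maps.\<close>

definition transporter :: "('a \<Rightarrow> 'a) set \<Rightarrow> 'a \<Rightarrow> 'a \<Rightarrow> ('a \<Rightarrow> 'a)"
  where "transporter H x y = (THE h. h \<in> H \<and> h x = y)"

text \<open>The value 0 off the carrier only serves the requirement of \<^const>\<open>Metric_space\<close> that
  distances be nonnegative and symmetric on the whole type.\<close>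

definition rainbow_dist :: "'a set \<Rightarrow> ('a \<Rightarrow> 'a \<Rightarrow> real) \<Rightarrow> ('a \<Rightarrow> 'a) set \<Rightarrow>
    (('a \<Rightarrow> 'a) \<Rightarrow> real) \<Rightarrow> 'a \<times> nat \<Rightarrow> 'a \<times> nat \<Rightarrow> real"
  where "rainbow_dist X d H r = (\<lambda>(x, i) (y, j).
    if (x, i) \<in> X \<times> {0, 1} \<and> (y, j) \<in> X \<times> {0, 1} then
      (if i = j then d x y
       else if i = 0 then r (transporter H x y)
       else r (transporter H y x))
    else 0)"

definition rainbow_admissible :: "'a set \<Rightarrow> ('a \<Rightarrow> 'a \<Rightarrow> real) \<Rightarrow> ('a \<Rightarrow> 'a) set \<Rightarrow>
    (('a \<Rightarrow> 'a) \<Rightarrow> real) \<Rightarrow> bool"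
  where "rainbow_admissible X d H r \<longleftrightarrow>
    Metric_space X d \<and> one_homogeneous X d \<and>
    subgroup H (Aut_group X d) \<and>
    comm_group ((Aut_group X d)\<lparr>carrier := H\<rparr>) \<and>
    (\<forall>x\<in>X. \<forall>y\<in>X. \<exists>!h. h \<in> H \<and> h x = y) \<and>
    (\<exists>g\<in>Aut X d.
       g \<otimes>\<^bsub>Aut_group X d\<^esub> g = \<one>\<^bsub>Aut_group X d\<^esub> \<and>
       (\<forall>h\<in>H. g \<otimes>\<^bsub>Aut_group X d\<^esub> h \<otimes>\<^bsub>Aut_group X d\<^esub> inv\<^bsub>Aut_group X d\<^esub> g
               = inv\<^bsub>Aut_group X d\<^esub> h)) \<and>
    r \<in> H \<rightarrow> {0<..} - Dist X d \<and> inj_on r H \<and>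
    (\<forall>p \<in> X \<times> {0, 1}. \<forall>p' \<in> X \<times> {0, 1}. \<forall>p'' \<in> X \<times> {0, 1}.
       rainbow_dist X d H r p p'' \<le> rainbow_dist X d H r p p' + rainbow_dist X d H r p' p'')"

text \<open>\<open>X \<times>\<^sub>r 2\<close> is the carrier \<open>X \<times> {0, 1}\<close> with \<^const>\<open>rainbow_dist\<close>; for admissible parameters
  it is a metric space.\<close>

lemma Metric_space_rainbow_dist:
  assumes "rainbow_admissible X d H r"
  shows "Metric_space (X \<times> {0, 1}) (rainbow_dist X d H r)"
proof -
  interpret X: Metric_space X d
    using assms by (simp add: rainbow_admissible_def)
  have tr: "transporter H x y \<in> H" if "x \<in> X" "y \<in> X" for x y
  proof -
    have "\<exists>!h. h \<in> H \<and> h x = y"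
      using assms that by (simp add: rainbow_admissible_def)
    from theI'[OF this] show ?thesis
      by (simp add: transporter_def)
  qed
  have pos: "0 < r (transporter H x y)" if "x \<in> X" "y \<in> X" for x y
    using assms tr[OF that] by (auto simp: rainbow_admissible_def Pi_iff)
  show ?thesis
  proof
    fix p q :: "'a \<times> nat"
    show "0 \<le> rainbow_dist X d H r p q"
      using pos by (auto simp: rainbow_dist_def less_imp_le split: prod.splits)
    show "rainbow_dist X d H r p q = rainbow_dist X d H r q p"
      by (auto simp: rainbow_dist_def X.commute split: prod.splits)
    show "rainbow_dist X d H r p q = 0 \<longleftrightarrow> p = q"
      if "p \<in> X \<times> {0, 1}" "q \<in> X \<times> {0, 1}"
      using that pos by (force simp: rainbow_dist_def)
  next
    fix p q s :: "'a \<times> nat"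
    assume "p \<in> X \<times> {0, 1}" "q \<in> X \<times> {0, 1}" "s \<in> X \<times> {0, 1}"
    then show "rainbow_dist X d H r p s \<le> rainbow_dist X d H r p q + rainbow_dist X d H r q s"
      using assms unfolding rainbow_admissible_def by blast
  qed
qed

end

theory Submission
  imports Defs
begin

text \<open>The engine of the proof is that a distance realised between the two components determines
  its second endpoint: if \<open>x\<close> and \<open>y\<close> lie in different components, no other point is as far from
  \<open>x\<close> as \<open>y\<close> is, since otherwise \<open>x\<close> and \<open>y\<close> would be isosceles-related (\<open>cross_unique\<close>).

  Three consequences follow. An automorphism is determined by one value (\<open>Aut_eqI\<close>), because it is
  then determined on the opposite component and hence everywhere; with 1-homogeneity this makes
  \<open>Aut(Y)\<close> sharply transitive. A distance occurring across the components never occurs inside one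
  of them (\<open>cross_distance\<close>), so each such distance \<open>q\<close> gives a matching \<open>f\<^sub>q\<close> of the two
  components, and by uniqueness \<open>f\<^sub>q\<close> is an involution that commutes with every automorphism.
  Finally, an automorphism \<open>g\<close> that exchanges the components is an involution
  (\<open>swap_involution\<close>): both \<open>g (g y)\<close> and \<open>y\<close> are at distance \<open>d y (g y)\<close> from \<open>g y\<close>.

  The last point carries the group theory. If \<open>h\<close> preserves the components and \<open>g\<close> exchanges them,
  then \<open>g h\<close> exchanges them as well, so \<open>g h g h = 1\<close>, that is, \<open>g\<close> conjugates \<open>h\<close> to its inverse.
  Inversion is thus an automorphism of \<open>Aut\<^sub>*(Y)\<close>, and so \<open>Aut\<^sub>*(Y)\<close> is Abelian
  (\<open>Aut_star_commute\<close>). The same relation makes \<open>f\<^sub>q\<close> isometric on a component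
  (\<open>f_isometry\<close>): if \<open>h x = y\<close> and \<open>g\<close> exchanges \<open>x\<close> and \<open>f\<^sub>q x\<close>, then
  \<open>d (f\<^sub>q x) (f\<^sub>q y) = d (g x) (h (g x)) = d x (h\<^sup>-\<^sup>1 x) = d (h x) x\<close>. Moreover \<open>f\<^sub>q \<circ> g\<close> restricted
  to \<open>X\<close> is the involution of \<open>X\<close> inverting \<open>H\<close> that the rainbow construction asks for
  (\<open>ex_inverter\<close>).

  With \<open>r h = d x (f\<^sub>q (h x))\<close>, which does not depend on \<open>x\<close> because \<open>H\<close> is Abelian and commutes with
  \<open>f\<^sub>q\<close>, the rainbow distance is the pullback of \<open>d\<close> along \<open>\<langle>x, i\<rangle> \<mapsto> f\<^sub>q\<^sup>i x\<close>
  (\<open>rainbow_dist_eq\<close>), so the triangle inequality and the isometry come for free.\<close>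

section \<open>The group of self-isometries\<close>

lemma Aut_iff:
  "f \<in> Aut M d \<longleftrightarrow> f \<in> extensional M \<and> bij_betw f M M \<and> (\<forall>x\<in>M. \<forall>y\<in>M. d (f x) (f y) = d x y)"
  by (auto simp: Aut_def Bij_def isometry_betw_def)

lemma Aut_mem: "f \<in> Aut M d \<Longrightarrow> x \<in> M \<Longrightarrow> f x \<in> M"
  by (auto simp: Aut_iff bij_betw_def)

lemma Aut_dist: "f \<in> Aut M d \<Longrightarrow> x \<in> M \<Longrightarrow> y \<in> M \<Longrightarrow> d (f x) (f y) = d x y"
  by (simp add: Aut_iff)

lemma Aut_inj: "f \<in> Aut M d \<Longrightarrow> x \<in> M \<Longrightarrow> y \<in> M \<Longrightarrow> f x = f y \<longleftrightarrow> x = y"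
  by (auto simp: Aut_iff bij_betw_def inj_on_def)

lemma Aut_extensional: "f \<in> Aut M d \<Longrightarrow> f \<in> extensional M"
  by (simp add: Aut_iff)

lemma Aut_compose:
  assumes "f \<in> Aut M d" "g \<in> Aut M d"
  shows "compose M f g \<in> Aut M d"
  using assms Aut_mem[of g M d]
  by (auto simp: Aut_iff compose_eq bij_betw_compose)

lemma isometry_betw_inv_into:
  assumes "isometry_betw M d N e f"
  shows "isometry_betw N e M d (inv_into M f)"
  unfolding isometry_betw_def
proof (intro conjI ballI)
  have f: "bij_betw f M N"
    using assms by (simp add: isometry_betw_def)
  then show "bij_betw (inv_into M f) N M"
    by (rule bij_betw_inv_into)
  fix x y assume "x \<in> N" "y \<in> N"
  then obtain u v where uv: "u \<in> M" "v \<in> M" "x = f u" "y = f v"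
    using f by (auto simp: bij_betw_def)
  then show "d (inv_into M f x) (inv_into M f y) = e x y"
    using assms by (simp add: isometry_betw_def bij_betw_inv_into_left[OF f])
qed

lemma Aut_inverse:
  assumes "f \<in> Aut M d"
  shows "(\<lambda>x\<in>M. inv_into M f x) \<in> Aut M d"
proof -
  have "isometry_betw M d M d (inv_into M f)"
    using assms by (auto simp: Aut_def intro: isometry_betw_inv_into)
  then show ?thesis
    by (auto simp: Aut_iff isometry_betw_def cong: bij_betw_cong)
qed

lemma subgroup_Aut: "subgroup (Aut M d) (BijGroup M)"
proof -
  interpret group "BijGroup M" by (rule group_BijGroup)
  have sub: "Aut M d \<subseteq> Bij M"
    by (auto simp: Aut_def)
  show ?thesis
  proof (rule subgroupI)
    show "Aut M d \<subseteq> carrier (BijGroup M)"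
      using sub by (simp add: BijGroup_def)
    have "(\<lambda>x\<in>M. x) \<in> Aut M d"
      using id_Bij[of M] by (auto simp: Aut_iff Bij_def)
    then show "Aut M d \<noteq> {}" by blast
  next
    fix f assume "f \<in> Aut M d"
    then show "inv\<^bsub>BijGroup M\<^esub> f \<in> Aut M d"
      using sub by (auto simp: inv_BijGroup Aut_inverse)
  next
    fix f g assume "f \<in> Aut M d" "g \<in> Aut M d"
    then show "f \<otimes>\<^bsub>BijGroup M\<^esub> g \<in> Aut M d"
      using sub by (auto simp: BijGroup_def Aut_compose)
  qed
qed

lemma group_Aut_group: "group (Aut_group M d)"
  unfolding Aut_group_def
  by (rule subgroup.subgroup_is_group[OF subgroup_Aut group_BijGroup])

lemma carrier_Aut_group: "carrier (Aut_group M d) = Aut M d"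
  by (simp add: Aut_group_def)

lemma one_Aut_group: "\<one>\<^bsub>Aut_group M d\<^esub> = (\<lambda>x\<in>M. x)"
  by (simp add: Aut_group_def BijGroup_def)

lemma mult_Aut_group:
  "f \<in> Aut M d \<Longrightarrow> g \<in> Aut M d \<Longrightarrow> f \<otimes>\<^bsub>Aut_group M d\<^esub> g = compose M f g"
  by (simp add: Aut_group_def BijGroup_def Aut_def)

section \<open>Isosceles-generated components under isometries\<close>

lemma equiv_isosceles_rel: "equiv M (isosceles_rel M d)"
proof -
  let ?S = "{(x, y). x \<in> M \<and> y \<in> M \<and> (\<exists>z\<in>M. z \<noteq> y \<and> d x y = d x z)}"
  have "equiv M (M \<times> M)"
    by (auto simp: equiv_def refl_on_def sym_def trans_def)
  moreover have "?S \<subseteq> M \<times> M" by auto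
  ultimately have ne: "M \<times> M \<in> {t. equiv M t \<and> ?S \<subseteq> t}" by blast
  show ?thesis
    unfolding isosceles_rel_def hull_def
  proof (rule equivI)
    show "\<Inter>{t. equiv M t \<and> ?S \<subseteq> t} \<subseteq> M \<times> M" using ne by blast
    show "refl_on M (\<Inter>{t. equiv M t \<and> ?S \<subseteq> t})"
      by (auto simp: equiv_def refl_on_def)
    show "sym (\<Inter>{t. equiv M t \<and> ?S \<subseteq> t})"
      unfolding sym_def equiv_def by blast
    show "trans (\<Inter>{t. equiv M t \<and> ?S \<subseteq> t})"
      by (rule transI) (auto simp: equiv_def dest: transD)
  qed
qed

lemma isosceles_relI:
  "x \<in> M \<Longrightarrow> y \<in> M \<Longrightarrow> z \<in> M \<Longrightarrow> z \<noteq> y \<Longrightarrow> d x y = d x z \<Longrightarrow> (x, y) \<in> isosceles_rel M d"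
  unfolding isosceles_rel_def by (rule hull_inc) blast

text \<open>The pullback of the target relation along \<open>f\<close> is an equivalence relation
  that contains all isosceles pairs, hence contains the relation that they generate.\<close>

lemma isosceles_rel_isometry_imp:
  assumes f: "isometry_betw M d N e f" and "(x, y) \<in> isosceles_rel M d"
  shows "(f x, f y) \<in> isosceles_rel N e"
proof -
  let ?R = "{(x, y). x \<in> M \<and> y \<in> M \<and> (f x, f y) \<in> isosceles_rel N e}"
  have mem: "f x \<in> N" if "x \<in> M" for x
    using f that by (auto simp: isometry_betw_def bij_betw_def)
  have "equiv M ?R"
    using equiv_isosceles_rel[of N e] mem
    unfolding equiv_def refl_on_def sym_def trans_def by blast
  moreover have "{(x, y). x \<in> M \<and> y \<in> M \<and> (\<exists>z\<in>M. z \<noteq> y \<and> d x y = d x z)} \<subseteq> ?R"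
  proof clarify
    fix x y z assume xyz: "x \<in> M" "y \<in> M" "z \<in> M" "z \<noteq> y" "d x y = d x z"
    then have "f z \<noteq> f y" "e (f x) (f y) = e (f x) (f z)"
      using f by (auto simp: isometry_betw_def bij_betw_def inj_on_def)
    then show "(f x, f y) \<in> isosceles_rel N e"
      using xyz mem isosceles_relI by metis
  qed
  ultimately have "isosceles_rel M d \<subseteq> ?R"
    unfolding isosceles_rel_def[of M d] by (rule hull_minimal[rotated])
  then show ?thesis
    using assms(2) by blast
qed

lemma isosceles_rel_isometry:
  assumes f: "isometry_betw M d N e f" and "x \<in> M" "y \<in> M"
  shows "(f x, f y) \<in> isosceles_rel N e \<longleftrightarrow> (x, y) \<in> isosceles_rel M d"
proof
  have bij: "bij_betw f M N"
    using f by (simp add: isometry_betw_def)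
  assume "(f x, f y) \<in> isosceles_rel N e"
  from isosceles_rel_isometry_imp[OF isometry_betw_inv_into[OF f] this]
  show "(x, y) \<in> isosceles_rel M d"
    unfolding bij_betw_inv_into_left[OF bij \<open>x \<in> M\<close>] bij_betw_inv_into_left[OF bij \<open>y \<in> M\<close>] .
qed (rule isosceles_rel_isometry_imp[OF f])

lemma isosceles_components_isometry:
  assumes f: "isometry_betw M d N e f"
  shows "isosceles_components N e = (`) f ` isosceles_components M d"
proof -
  have surj: "f ` M = N"
    using f by (simp add: isometry_betw_def bij_betw_def)
  have "isosceles_rel N e `` {f x} = f ` (isosceles_rel M d `` {x})" if "x \<in> M" for x
  proof -
    have "isosceles_rel N e `` {f x} \<subseteq> N" "isosceles_rel M d `` {x} \<subseteq> M"
      using equiv_isosceles_rel[of N e] equiv_isosceles_rel[of M d] unfolding equiv_def by blast+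
    then show ?thesis
      using surj isosceles_rel_isometry[OF f that] by blast
  qed
  then show ?thesis
    unfolding isosceles_components_def quotient_def surj[symmetric] by auto
qed

lemma isosceles_component_subset: "C \<in> isosceles_components M d \<Longrightarrow> C \<subseteq> M"
  unfolding isosceles_components_def by (rule in_quotient_imp_subset[OF equiv_isosceles_rel])

lemma subgroup_Aut_star: "subgroup (Aut_star M d) (Aut_group M d)"
proof -
  interpret group "Aut_group M d" by (rule group_Aut_group)
  have image: "compose M f g ` C = f ` g ` C" if "C \<in> isosceles_components M d" for f g C
    using isosceles_component_subset[OF that] by (force simp: compose_def)
  show ?thesis
  proof (rule subgroupI)
    show "Aut_star M d \<subseteq> carrier (Aut_group M d)"
      by (auto simp: Aut_star_def carrier_Aut_group)
    have "(\<lambda>x\<in>M. x) ` C = C" if "C \<in> isosceles_components M d" for C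
      using isosceles_component_subset[OF that] by force
    then have "\<one>\<^bsub>Aut_group M d\<^esub> \<in> Aut_star M d"
      using one_closed by (simp add: Aut_star_def carrier_Aut_group one_Aut_group)
    then show "Aut_star M d \<noteq> {}" by blast
  next
    fix f assume f: "f \<in> Aut_star M d"
    define g where "g = inv\<^bsub>Aut_group M d\<^esub> f"
    have A: "f \<in> Aut M d" "g \<in> Aut M d"
      using f inv_closed[of f] by (auto simp: Aut_star_def carrier_Aut_group g_def)
    have "g ` C = C" if "C \<in> isosceles_components M d" for C
    proof -
      have "compose M g f = (\<lambda>x\<in>M. x)"
        using l_inv[of f] A mult_Aut_group[OF A(2,1)]
        by (simp add: carrier_Aut_group one_Aut_group flip: g_def)
      then have "g ` f ` C = (\<lambda>x\<in>M. x) ` C"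
        using image[OF that, of g f] by simp
      moreover have "(\<lambda>x\<in>M. x) ` C = C"
        using isosceles_component_subset[OF that] by force
      ultimately show ?thesis
        using f that by (auto simp: Aut_star_def)
    qed
    then show "inv\<^bsub>Aut_group M d\<^esub> f \<in> Aut_star M d"
      using A by (simp add: Aut_star_def g_def)
  next
    fix f g assume "f \<in> Aut_star M d" "g \<in> Aut_star M d"
    then show "f \<otimes>\<^bsub>Aut_group M d\<^esub> g \<in> Aut_star M d"
      by (auto simp: Aut_star_def mult_Aut_group Aut_compose image)
  qed
qed

lemma group_Aut_star_group: "group (Aut_star_group M d)"
  unfolding Aut_star_group_def
  by (rule subgroup.subgroup_is_group[OF subgroup_Aut_star group_Aut_group])

lemma carrier_Aut_star_group: "carrier (Aut_star_group M d) = Aut_star M d"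
  by (simp add: Aut_star_group_def)

lemma mult_Aut_star_group:
  "f \<in> Aut_star M d \<Longrightarrow> g \<in> Aut_star M d \<Longrightarrow> f \<otimes>\<^bsub>Aut_star_group M d\<^esub> g = compose M f g"
  by (simp add: Aut_star_group_def mult_Aut_group Aut_star_def)

lemma Aut_star_Aut: "f \<in> Aut_star M d \<Longrightarrow> f \<in> Aut M d"
  by (simp add: Aut_star_def)

text \<open>Conjugation by an isometry fixes each component because \<open>f\<close> maps the components of
  the source onto those of the target.\<close>

lemma Aut_star_conjugate:
  assumes f: "isometry_betw M d N e f" and k: "k \<in> Aut_star M d"
  shows "(\<lambda>y\<in>N. f (k (inv_into M f y))) \<in> Aut_star N e" (is "?k \<in> _")
proof -
  have bij: "bij_betw f M N"
    using f by (simp add: isometry_betw_def)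
  note left = bij_betw_inv_into_left[OF bij]
  have f_mem: "f x \<in> N" if "x \<in> M" for x
    using bij that by (auto simp: bij_betw_def)
  have kA: "k \<in> Aut M d"
    using k by (rule Aut_star_Aut)
  have "bij_betw (f \<circ> (k \<circ> inv_into M f)) N N"
    using bij kA bij_betw_inv_into[OF bij] by (auto simp: Aut_iff intro: bij_betw_trans)
  then have "bij_betw ?k N N"
    by (rule bij_betw_cong[THEN iffD1, rotated]) simp
  moreover have "e (?k y) (?k z) = e y z" if "y \<in> N" "z \<in> N" for y z
    using that f kA bij_betw_inv_into[OF bij] isometry_betw_inv_into[OF f]
    by (auto simp: isometry_betw_def Aut_dist Aut_mem bij_betw_def inv_into_into)
  ultimately have "?k \<in> Aut N e"
    by (simp add: Aut_iff)
  moreover have "?k ` D = D" if D: "D \<in> isosceles_components N e" for D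
  proof -
    obtain C where C: "C \<in> isosceles_components M d" "D = f ` C"
      using D unfolding isosceles_components_isometry[OF f] by blast
    have "?k (f x) = f (k x)" if "x \<in> C" for x
      using that isosceles_component_subset[OF C(1)] by (auto simp: left f_mem)
    then have "?k ` D = f ` k ` C"
      unfolding C(2) image_image by (rule image_cong[OF refl])
    then show ?thesis
      using k C by (simp add: Aut_star_def)
  qed
  ultimately show ?thesis
    by (simp add: Aut_star_def)
qed

text \<open>Surjectivity needs no separate computation: a preimage of \<open>k\<close> is its
  conjugate by the inverse isometry.\<close>

lemma iso_Aut_star_conjugate:
  assumes f: "isometry_betw M d N e f"
  shows "(\<lambda>k. \<lambda>y\<in>N. f (k (inv_into M f y))) \<in> iso (Aut_star_group M d) (Aut_star_group N e)"
    (is "?c \<in> _")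
proof -
  have bij: "bij_betw f M N"
    using f by (simp add: isometry_betw_def)
  note left = bij_betw_inv_into_left[OF bij]
  have f_mem: "f x \<in> N" if "x \<in> M" for x
    using bij that by (auto simp: bij_betw_def)
  have inv_mem: "inv_into M f y \<in> M" if "y \<in> N" for y
    using bij that by (simp add: bij_betw_def inv_into_into)
  note closed = Aut_star_conjugate[OF f]
  show ?thesis
    unfolding iso_iff
  proof (intro conjI)
    show "?c \<in> hom (Aut_star_group M d) (Aut_star_group N e)"
    proof (rule homI; unfold carrier_Aut_star_group)
      fix k l assume kl: "k \<in> Aut_star M d" "l \<in> Aut_star M d"
      have "l x \<in> M" if "x \<in> M" for x
        using kl(2)[THEN Aut_star_Aut, THEN Aut_mem, OF that] .
      then have "?c (compose M k l) = compose N (?c k) (?c l)"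
        by (auto simp: compose_def left f_mem inv_mem intro!: ext)
      then show "?c (k \<otimes>\<^bsub>Aut_star_group M d\<^esub> l) = ?c k \<otimes>\<^bsub>Aut_star_group N e\<^esub> ?c l"
        using mult_Aut_star_group[OF kl] mult_Aut_star_group[OF kl[THEN closed]] by simp
    qed (rule closed)
    show "inj_on ?c (carrier (Aut_star_group M d))"
      unfolding carrier_Aut_star_group
    proof (rule inj_onI)
      fix k l assume kl: "k \<in> Aut_star M d" "l \<in> Aut_star M d" and eq: "?c k = ?c l"
      note A = kl[THEN Aut_star_Aut]
      show "k = l"
      proof (rule extensionalityI[OF A[THEN Aut_extensional]])
        fix x assume x: "x \<in> M"
        have "f (k x) = f (l x)"
          using fun_cong[OF eq, of "f x"] x by (simp add: f_mem left)
        then show "k x = l x"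
          using bij A[THEN Aut_mem, OF x] by (auto simp: bij_betw_def inj_on_def)
      qed
    qed
    show "?c ` carrier (Aut_star_group M d) = carrier (Aut_star_group N e)"
      unfolding carrier_Aut_star_group
    proof
      show "?c ` Aut_star M d \<subseteq> Aut_star N e"
        using closed by blast
      show "Aut_star N e \<subseteq> ?c ` Aut_star M d"
      proof
        fix k assume k: "k \<in> Aut_star N e"
        let ?l = "\<lambda>x\<in>M. inv_into M f (k (inv_into N (inv_into M f) x))"
        have "inv_into N (inv_into M f) x = f x" if "x \<in> M" for x
          using bij that by (rule inv_into_inv_into_eq)
        then have "f (?l (inv_into M f y)) = k y" if "y \<in> N" for y
          using that Aut_mem[OF Aut_star_Aut[OF k] that]
          by (simp add: inv_mem bij_betw_inv_into_right[OF bij])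
        then have "k = ?c ?l"
          using Aut_extensional[OF Aut_star_Aut[OF k]] by (auto simp: fun_eq_iff extensional_def)
        moreover have "?l \<in> Aut_star M d"
          by (rule Aut_star_conjugate[OF isometry_betw_inv_into[OF f] k])
        ultimately show "k \<in> ?c ` Aut_star M d"
          by blast
      qed
    qed
  qed
qed

text \<open>Since \<open>\<psi>\<close> agrees with \<open>c\<close> after the inverse of \<open>\<rho>\<close>, it inherits both the homomorphism
  property and bijectivity. It is used to read off the isomorphism with \<open>Aut\<^sub>*(X \<times> 2)\<close> on
  restrictions \<open>h|\<^sub>X\<close> from conjugation on the unrestricted \<open>h\<close>.\<close>

lemma iso_of_comp_iso:
  assumes A: "group A"
    and \<rho>: "\<rho> \<in> iso A B" and c: "c \<in> iso A C"
    and eq: "\<And>a. a \<in> carrier A \<Longrightarrow> \<psi> (\<rho> a) = c a"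
  shows "\<psi> \<in> iso B C"
proof -
  have "c \<circ> inv_into (carrier A) \<rho> \<in> iso B C"
    using iso_set_trans[OF group.iso_set_sym[OF A \<rho>] c] .
  moreover have "\<psi> b = (c \<circ> inv_into (carrier A) \<rho>) b" if b: "b \<in> carrier B" for b
    using \<rho> b eq[of "inv_into (carrier A) \<rho> b"]
    by (simp add: iso_def bij_betw_def f_inv_into_f inv_into_into)
  moreover have "x \<otimes>\<^bsub>B\<^esub> y \<in> carrier B" if xy: "x \<in> carrier B" "y \<in> carrier B" for x y
  proof -
    have surj: "\<rho> ` carrier A = carrier B" and hom: "\<rho> \<in> hom A B"
      using \<rho> by (simp_all add: iso_iff)
    then obtain a b where ab: "a \<in> carrier A" "b \<in> carrier A" "x = \<rho> a" "y = \<rho> b"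
      using xy by blast
    then have "x \<otimes>\<^bsub>B\<^esub> y = \<rho> (a \<otimes>\<^bsub>A\<^esub> b)"
      using hom_mult[OF hom ab(1,2)] by simp
    then show ?thesis
      using surj ab monoid.m_closed[OF group.is_monoid[OF A]] by blast
  qed
  ultimately have "bij_betw \<psi> (carrier B) (carrier C)" "\<psi> \<in> hom B C"
    using bij_betw_cong[of "carrier B" \<psi> "c \<circ> inv_into (carrier A) \<rho>" "carrier C"]
    by (auto simp only: iso_def hom_def Pi_iff mem_Collect_eq)
  then show ?thesis
    by (rule isoI[rotated])
qed

section \<open>Two components\<close>

text \<open>Below, that \<open>x\<close> and \<open>y\<close> lie in different components is written
  \<open>(x \<in> X) \<noteq> (y \<in> X)\<close>; this treats the two components symmetrically and avoids
  repeated case distinctions.\<close>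

locale two_components = Metric_space M d for M :: "'a set" and d +
  fixes X X' :: "'a set"
  assumes homogeneous: "one_homogeneous M d"
    and components: "isosceles_components M d = {X, X'}"
    and distinct: "X \<noteq> X'"
begin

lemma component_quotient: "X \<in> M // isosceles_rel M d" "X' \<in> M // isosceles_rel M d"
  using components by (auto simp: isosceles_components_def)

lemma Un_components: "X \<union> X' = M"
  using Union_quotient[OF equiv_isosceles_rel, of M d] components
  by (simp add: isosceles_components_def)

lemma disjoint_components: "X \<inter> X' = {}"
  using quotient_disj[OF equiv_isosceles_rel component_quotient] distinct by blast

lemma mem_X'_iff: "x \<in> M \<Longrightarrow> x \<in> X' \<longleftrightarrow> x \<notin> X"
  using Un_components disjoint_components by blast

lemma X_subset: "x \<in> X \<Longrightarrow> x \<in> M"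
  using Un_components by blast

lemma obtain_sides:
  obtains x0 x1 where "x0 \<in> X" "x0 \<in> M" "x1 \<in> M" "x1 \<notin> X"
proof -
  have "X \<noteq> {}" "X' \<noteq> {}"
    using component_quotient in_quotient_imp_non_empty[OF equiv_isosceles_rel] by blast+
  then show thesis
    using that Un_components disjoint_components by blast
qed

lemma isosceles_rel_iff:
  assumes "x \<in> M" "y \<in> M"
  shows "(x, y) \<in> isosceles_rel M d \<longleftrightarrow> (x \<in> X \<longleftrightarrow> y \<in> X)"
proof
  note closed = in_quotient_imp_closed[OF equiv_isosceles_rel]
  assume "(x, y) \<in> isosceles_rel M d"
  then show "x \<in> X \<longleftrightarrow> y \<in> X"
    using closed[OF component_quotient(1)] closed[OF component_quotient(2)] assms mem_X'_iff
    by blast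
next
  assume "x \<in> X \<longleftrightarrow> y \<in> X"
  then have "x \<in> X \<and> y \<in> X \<or> x \<in> X' \<and> y \<in> X'"
    using assms mem_X'_iff by blast
  then show "(x, y) \<in> isosceles_rel M d"
    using quotient_eq_iff[OF equiv_isosceles_rel, of _ M d] component_quotient by blast
qed

text \<open>The rigidity from which everything else follows: two distinct points \<open>y\<close>, \<open>z\<close>
  equally far from \<open>x\<close> would put \<open>x\<close> and \<open>y\<close> into the same component.\<close>

lemma cross_unique:
  assumes "x \<in> M" "y \<in> M" "z \<in> M" "(x \<in> X) \<noteq> (y \<in> X)" "d x z = d x y"
  shows "z = y"
  using isosceles_relI[of x M y z d] assms isosceles_rel_iff by metis

lemma Aut_side:
  assumes "g \<in> Aut M d" "x \<in> M" "y \<in> M"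
  shows "(g x \<in> X \<longleftrightarrow> g y \<in> X) \<longleftrightarrow> (x \<in> X \<longleftrightarrow> y \<in> X)"
proof -
  have "isometry_betw M d M d g"
    using assms by (simp add: Aut_def)
  from isosceles_rel_isometry[OF this assms(2,3)] show ?thesis
    using assms by (simp add: isosceles_rel_iff Aut_mem)
qed

lemma obtain_Aut:
  assumes "x \<in> M" "y \<in> M"
  obtains g where "g \<in> Aut M d" "g x = y"
  using homogeneous assms by (auto simp: one_homogeneous_def)

lemma Aut_star_iff: "g \<in> Aut_star M d \<longleftrightarrow> g \<in> Aut M d \<and> (\<forall>x\<in>M. g x \<in> X \<longleftrightarrow> x \<in> X)"
proof -
  have "g ` X = X \<and> g ` X' = X' \<longleftrightarrow> (\<forall>x\<in>M. g x \<in> X \<longleftrightarrow> x \<in> X)" if g: "g \<in> Aut M d"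
  proof
    assume "g ` X = X \<and> g ` X' = X'"
    then show "\<forall>x\<in>M. g x \<in> X \<longleftrightarrow> x \<in> X"
      using mem_X'_iff Un_components disjoint_components by blast
  next
    assume side: "\<forall>x\<in>M. g x \<in> X \<longleftrightarrow> x \<in> X"
    have surj: "g ` M = M"
      using g by (simp add: Aut_iff bij_betw_def)
    have "g ` X \<subseteq> X"
      using side X_subset by blast
    moreover have "g ` X' \<subseteq> X'"
      using side surj Un_components disjoint_components by blast
    ultimately show "g ` X = X \<and> g ` X' = X'"
      using surj Un_components disjoint_components by blast
  qed
  then show ?thesis
    by (auto simp: Aut_star_def components)
qed

text \<open>Automorphisms permute the components, and there are only two, so the behaviour at
  one point decides whether they are fixed or exchanged.\<close>

lemma Aut_starI:
  assumes "g \<in> Aut M d" "x \<in> M" "g x \<in> X \<longleftrightarrow> x \<in> X"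
  shows "g \<in> Aut_star M d"
  using assms Aut_side unfolding Aut_star_iff by blast

text \<open>By rigidity, agreement at one point spreads to the opposite component, and from there
  back to the component of the starting point.\<close>

lemma Aut_eqI:
  assumes g: "g \<in> Aut M d" and h: "h \<in> Aut M d" and x: "x \<in> M" "g x = h x"
  shows "g = h"
proof -
  have other: "g z = h z" if "y \<in> M" "z \<in> M" "(y \<in> X) \<noteq> (z \<in> X)" "g y = h y" for y z
  proof (rule cross_unique)
    show "d (h y) (g z) = d (h y) (h z)"
      using that g h Aut_dist by metis
    show "(h y \<in> X) \<noteq> (h z \<in> X)"
      using Aut_side[OF h] that by blast
  qed (use that g h in \<open>simp_all add: Aut_mem\<close>)
  obtain z where z: "z \<in> M" "(x \<in> X) \<noteq> (z \<in> X)"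
    using obtain_sides by metis
  then have gz: "g z = h z"
    using other x by blast
  show ?thesis
  proof (rule extensionalityI[OF Aut_extensional[OF g] Aut_extensional[OF h]])
    fix y assume y: "y \<in> M"
    then have "(x \<in> X) \<noteq> (y \<in> X) \<or> (z \<in> X) \<noteq> (y \<in> X)"
      using z by blast
    then show "g y = h y"
      using other[OF x(1) y _ x(2)] other[OF z(1) y _ gz] by blast
  qed
qed

text \<open>Moving \<open>x\<close> to \<open>z\<close> by an automorphism \<open>g\<close>, rigidity at \<open>z\<close> forces \<open>w = g y\<close>.\<close>

lemma cross_distance:
  assumes x: "x \<in> M" and y: "y \<in> M" and z: "z \<in> M" and w: "w \<in> M"
    and "(x \<in> X) \<noteq> (y \<in> X)" "d z w = d x y"
  shows "(z \<in> X) \<noteq> (w \<in> X)"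
proof -
  obtain g where g: "g \<in> Aut M d" "g x = z"
    using obtain_Aut[OF x z] .
  have side: "(z \<in> X) \<noteq> (g y \<in> X)"
    using Aut_side[OF g(1) x y] g(2) assms by blast
  moreover have "d z w = d z (g y)"
    using assms g Aut_dist[OF g(1) x y] by simp
  ultimately have "w = g y"
    using z w y g by (intro cross_unique[of z]) (auto simp: Aut_mem)
  then show ?thesis
    using side by simp
qed

text \<open>Both \<open>g (g y)\<close> and \<open>y\<close> have distance \<open>d y (g y)\<close> from \<open>g y\<close>, which lies in the
  other component than \<open>y\<close>.\<close>

lemma swap_involution:
  assumes g: "g \<in> Aut M d" and x: "x \<in> M" "(g x \<in> X) \<noteq> (x \<in> X)" and y: "y \<in> M"
  shows "g (g y) = y"
proof -
  have "(g y \<in> X) \<noteq> (y \<in> X)"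
    using Aut_side[OF g x(1) y] x(2) by blast
  moreover have "d (g y) (g (g y)) = d (g y) y"
    using g y by (simp add: Aut_mem Aut_dist commute)
  ultimately show ?thesis
    using g y by (intro cross_unique[of "g y"]) (auto simp: Aut_mem)
qed

lemma obtain_swap:
  obtains g where "g \<in> Aut M d" "\<And>x. x \<in> M \<Longrightarrow> g x \<in> X \<longleftrightarrow> x \<notin> X" "\<And>x. x \<in> M \<Longrightarrow> g (g x) = x"
proof -
  obtain x0 x1 where x: "x0 \<in> M" "x0 \<in> X" "x1 \<in> M" "x1 \<notin> X"
    using obtain_sides .
  obtain g where g: "g \<in> Aut M d" "g x0 = x1"
    using obtain_Aut x by metis
  show thesis
  proof
    show "g \<in> Aut M d" by fact
    show "g x \<in> X \<longleftrightarrow> x \<notin> X" if "x \<in> M" for x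
      using Aut_side[OF g(1) x(1) that] g x by blast
    show "g (g y) = y" if "y \<in> M" for y
      using swap_involution[OF g(1) x(1) _ that] g x by simp
  qed
qed

text \<open>Since \<open>g \<circ> h\<close> also exchanges the components, it is an involution. The form
  \<open>h g h = g\<close> expresses that \<open>g\<close> conjugates \<open>h\<close> to its inverse without mentioning inverses.\<close>

lemma swap_inverts_Aut_star:
  assumes g: "g \<in> Aut M d" and x: "x \<in> M" "(g x \<in> X) \<noteq> (x \<in> X)"
    and h: "h \<in> Aut_star M d" and y: "y \<in> M"
  shows "h (g (h y)) = g y"
proof -
  have hA: "h \<in> Aut M d"
    using h by (rule Aut_star_Aut)
  have mem: "g y \<in> M" "h (g (h y)) \<in> M" "h x \<in> M" "h y \<in> M" "g (h y) \<in> M"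
    using g hA y x by (simp_all add: Aut_mem)
  have "(g (h x) \<in> X) \<noteq> (x \<in> X)"
    using x h mem Aut_side[OF g x(1) mem(3)] by (auto simp: Aut_star_iff)
  then have "compose M g h (compose M g h y) = y"
    using x y by (intro swap_involution[OF Aut_compose[OF g hA]]) (auto simp: compose_eq)
  then have "g (h (g (h y))) = y"
    using y mem by (simp add: compose_eq)
  moreover have "g (g y) = y"
    by (rule swap_involution[OF g x y])
  ultimately show ?thesis
    using Aut_inj[OF g mem(2) mem(1)] by simp
qed

text \<open>Inversion on \<open>Aut\<^sub>*\<close> is conjugation by a component-exchanging \<open>g\<close>, hence
  multiplicative. In terms of \<open>h g h = g\<close>: both \<open>h k g h k\<close> and \<open>h k g k h\<close> equal \<open>g\<close>, and
  cancelling \<open>h k g\<close> leaves \<open>h k = k h\<close>.\<close>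

lemma Aut_star_commute:
  assumes h: "h \<in> Aut_star M d" and k: "k \<in> Aut_star M d" and y: "y \<in> M"
  shows "h (k y) = k (h y)"
proof -
  obtain g where g: "g \<in> Aut M d" "\<And>x. x \<in> M \<Longrightarrow> g x \<in> X \<longleftrightarrow> x \<notin> X"
    using obtain_swap by metis
  note A = h[THEN Aut_star_Aut] k[THEN Aut_star_Aut]
  note mem = A[THEN Aut_mem] Aut_mem[OF g(1)]
  have inverts: "l (g (l z)) = g z" if "l \<in> Aut_star M d" "z \<in> M" for l z
    using swap_inverts_Aut_star[OF g(1) that(2) _ that] g(2)[OF that(2)] by blast
  have "compose M h k \<in> Aut_star M d"
    using h k A mem by (auto simp: Aut_star_iff compose_eq Aut_compose)
  from inverts[OF this y] have "h (k (g (h (k y)))) = g y"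
    using y mem by (simp add: compose_eq)
  also have "\<dots> = h (k (g (k (h y))))"
    using inverts h k y mem by metis
  finally show ?thesis
    using y A mem Aut_inj[OF A(1)] Aut_inj[OF A(2)] Aut_inj[OF g(1)] by simp
qed

section \<open>The matching of the two components at a fixed distance\<close>

text \<open>For the inclusion from right to left, homogeneity allows the first of two points
  at distance \<open>q\<close> to be moved into \<open>X\<close>; the second then cannot lie in \<open>X\<close> as well.\<close>

lemma cross_distances_eq: "{d x x' |x x'. x \<in> X \<and> x' \<in> X'} = Dist M d - Dist X d"
proof (intro equalityI subsetI)
  fix q assume "q \<in> {d x x' |x x'. x \<in> X \<and> x' \<in> X'}"
  then obtain x x' where q: "q = d x x'" "x \<in> X" "x' \<in> X'"
    by blast
  then have mem: "x \<in> M" "x' \<in> M" "x' \<notin> X"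
    using Un_components disjoint_components by blast+
  have "q \<notin> Dist X d"
  proof
    assume "q \<in> Dist X d"
    then obtain z w where "z \<in> X" "w \<in> X" "d z w = d x x'"
      using q by (auto simp: Dist_def)
    then show False
      using cross_distance[OF mem(1,2), of z w] mem q X_subset by blast
  qed
  moreover have "q \<in> Dist M d"
    unfolding Dist_def using q mem by blast
  ultimately show "q \<in> Dist M d - Dist X d"
    by blast
next
  fix q assume q: "q \<in> Dist M d - Dist X d"
  then obtain x y where xy: "x \<in> M" "y \<in> M" "q = d x y"
    by (auto simp: Dist_def)
  obtain x0 where x0: "x0 \<in> M" "x0 \<in> X"
    using obtain_sides by metis
  obtain g where g: "g \<in> Aut M d" "g x = x0"
    using obtain_Aut[OF xy(1) x0(1)] .
  have dist: "d x0 (g y) = q"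
    using Aut_dist[OF g(1) xy(1,2)] g xy by simp
  moreover have "g y \<notin> X"
    using q dist x0 by (auto simp: Dist_def)
  ultimately show "q \<in> {d x x' |x x'. x \<in> X \<and> x' \<in> X'}"
    using x0 Aut_mem[OF g(1) xy(2)] mem_X'_iff by blast
qed

text \<open>Homogeneity transports a cross pair at distance \<open>q\<close> to any prescribed first point.\<close>

lemma obtain_cross:
  assumes "q \<in> Dist M d - Dist X d" and y: "y \<in> M"
  obtains z where "z \<in> M" "(y \<in> X) \<noteq> (z \<in> X)" "d y z = q"
proof -
  obtain x x' where q: "q = d x x'" "x \<in> X" "x' \<in> X'"
    using assms unfolding cross_distances_eq[symmetric] by blast
  then have mem: "x \<in> M" "x' \<in> M" "x' \<notin> X"
    using Un_components disjoint_components by blast+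
  obtain g where g: "g \<in> Aut M d" "g x = y"
    using obtain_Aut[OF mem(1) y] .
  show thesis
  proof
    show "g x' \<in> M" using g mem by (simp add: Aut_mem)
    show "(y \<in> X) \<noteq> (g x' \<in> X)" using Aut_side[OF g(1) mem(1,2)] g mem q by blast
    show "d y (g x') = q" using Aut_dist[OF g(1) mem(1,2)] g q by simp
  qed
qed

lemma ex1_matching:
  assumes q: "q \<in> Dist M d - Dist X d"
  shows "\<exists>!f. f \<in> M \<rightarrow>\<^sub>E M \<and> (\<forall>y\<in>M. d y (f y) = q)"
proof -
  have "\<forall>y\<in>M. \<exists>z. z \<in> M \<and> (y \<in> X) \<noteq> (z \<in> X) \<and> d y z = q"
    using obtain_cross[OF q] by metis
  then obtain m where m: "\<And>y. y \<in> M \<Longrightarrow> m y \<in> M \<and> (y \<in> X) \<noteq> (m y \<in> X) \<and> d y (m y) = q"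
    by metis
  show ?thesis
  proof (rule ex1I)
    show "restrict m M \<in> M \<rightarrow>\<^sub>E M \<and> (\<forall>y\<in>M. d y (restrict m M y) = q)"
      using m by auto
    fix f assume f: "f \<in> M \<rightarrow>\<^sub>E M \<and> (\<forall>y\<in>M. d y (f y) = q)"
    have "f y = m y" if "y \<in> M" for y
      using cross_unique[of y "m y" "f y"] f m[OF that] that by auto
    then show "f = restrict m M"
      using f by (auto simp: fun_eq_iff PiE_def extensional_def)
  qed
qed

end

locale component_matching = two_components +
  fixes f :: "'a \<Rightarrow> 'a" and q :: real
  assumes colour: "q \<in> Dist M d - Dist X d"
    and f_funcset: "f \<in> M \<rightarrow>\<^sub>E M"
    and f_dist: "\<And>y. y \<in> M \<Longrightarrow> d y (f y) = q"
begin

lemma f_mem: "y \<in> M \<Longrightarrow> f y \<in> M"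
  using f_funcset by auto

lemma f_unique:
  assumes "y \<in> M" "z \<in> M" "d y z = q"
  shows "f y = z"
proof -
  obtain w where w: "w \<in> M" "(y \<in> X) \<noteq> (w \<in> X)" "d y w = q"
    using obtain_cross[OF colour assms(1)] .
  have "f y = w" "z = w"
    using assms w f_mem f_dist by (auto intro: cross_unique[OF assms(1) w(1) _ w(2)])
  then show ?thesis by simp
qed

lemma f_side:
  assumes "y \<in> M"
  shows "f y \<in> X \<longleftrightarrow> y \<notin> X"
proof -
  obtain w where w: "w \<in> M" "(y \<in> X) \<noteq> (w \<in> X)" "d y w = q"
    using obtain_cross[OF colour assms] .
  then show ?thesis
    using f_unique[OF assms w(1,3)] by blast
qed

lemma f_involution: "y \<in> M \<Longrightarrow> f (f y) = y"
  by (rule f_unique) (simp_all add: f_mem f_dist commute[of "f y"])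

text \<open>Automorphisms preserve the property \<open>d y z = q\<close> that characterises \<open>z = f y\<close>.\<close>

lemma f_commute:
  assumes "g \<in> Aut M d" "y \<in> M"
  shows "f (g y) = g (f y)"
  using assms by (intro f_unique) (simp_all add: Aut_mem Aut_dist f_mem f_dist)

text \<open>With \<open>h x = y\<close> and an automorphism \<open>g\<close> exchanging \<open>x\<close> and \<open>f x\<close>, one has
  \<open>f y = h (g x)\<close>; applying \<open>g\<close> and then \<open>h\<close> to both points turns the pair \<open>(f x, f y)\<close> into
  \<open>(y, x)\<close>, because \<open>h g h = g\<close>.\<close>

lemma f_isometry:
  assumes x: "x \<in> M" and y: "y \<in> M" and side: "x \<in> X \<longleftrightarrow> y \<in> X"
  shows "d (f x) (f y) = d x y"
proof -
  obtain h where h: "h \<in> Aut M d" "h x = y"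
    using obtain_Aut[OF x y] .
  then have hS: "h \<in> Aut_star M d"
    using Aut_starI[of h x] x side by blast
  obtain g where g: "g \<in> Aut M d" "g x = f x"
    using obtain_Aut[OF x f_mem[OF x]] .
  have swap: "(g x \<in> X) \<noteq> (x \<in> X)"
    using f_side[OF x] by (simp add: g(2))
  have mem: "h (g x) \<in> M" "g (h (g x)) \<in> M" "g x \<in> M"
    using g(1) h(1) x by (simp_all add: Aut_mem)
  have "f y = h (g x)"
    using f_commute[OF h(1) x] h g by simp
  then have "d (f x) (f y) = d (g x) (h (g x))"
    using g by simp
  also have "\<dots> = d (g (g x)) (g (h (g x)))"
    using mem g by (simp add: Aut_dist)
  also have "\<dots> = d x (g (h (g x)))"
    using swap_involution[OF g(1) x swap x] by simp
  also have "\<dots> = d (h x) (h (g (h (g x))))"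
    by (simp only: Aut_dist[OF h(1) x mem(2)])
  also have "\<dots> = d y x"
    using swap_inverts_Aut_star[OF g(1) x swap hS mem(3)] swap_involution[OF g(1) x swap x] h
    by simp
  finally show ?thesis
    by (simp add: commute)
qed

lemma f_image: "f ` X = X'" "f ` X' = X"
proof -
  have mem: "y \<in> M" if "y \<in> X \<or> y \<in> X'" for y
    using that Un_components by blast
  have sub: "f ` X \<subseteq> X'" "f ` X' \<subseteq> X"
    using f_side f_mem mem mem_X'_iff by auto
  have preimage: "y \<in> f ` A" if "f y \<in> A" "y \<in> M" for y A
    using imageI[OF that(1), of f] f_involution[OF that(2)] by simp
  show "f ` X = X'"
    using sub mem by (intro equalityI subsetI preimage) auto
  show "f ` X' = X"
    using sub mem by (intro equalityI subsetI preimage) auto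
qed

lemma f_inj: "x \<in> M \<Longrightarrow> y \<in> M \<Longrightarrow> f x = f y \<longleftrightarrow> x = y"
  using f_involution by metis

lemma isometry_betw_f: "isometry_betw X d X' d (restrict f X)"
  using f_image(1) f_isometry X_subset
  by (auto simp: isometry_betw_def bij_betw_def inj_on_def f_inj)

end

section \<open>Automorphisms restricted to one component\<close>

context two_components
begin

abbreviation H :: "('a \<Rightarrow> 'a) set"
  where "H \<equiv> {restrict h X |h. h \<in> Aut_star M d}"

abbreviation GH :: "('a \<Rightarrow> 'a) monoid"
  where "GH \<equiv> (Aut_group X d)\<lparr>carrier := H\<rparr>"

lemma Aut_star_mem_X: "k \<in> Aut_star M d \<Longrightarrow> x \<in> X \<Longrightarrow> k x \<in> X"
  using X_subset by (auto simp: Aut_star_iff)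

lemma restrict_Aut_star:
  assumes k: "k \<in> Aut_star M d"
  shows "restrict k X \<in> Aut X d"
proof -
  have "k ` X = X"
    using k by (simp add: Aut_star_def components)
  moreover have "inj_on k X"
    using Aut_inj[OF Aut_star_Aut[OF k]] X_subset by (simp add: inj_on_def)
  ultimately show ?thesis
    using Aut_dist[OF Aut_star_Aut[OF k]] X_subset by (simp add: Aut_iff bij_betw_def)
qed

lemma H_Aut: "h \<in> H \<Longrightarrow> h \<in> Aut X d"
  using restrict_Aut_star by blast

lemma hom_restrict: "(\<lambda>k. restrict k X) \<in> hom (Aut_star_group M d) (Aut_group X d)"
proof (rule homI; unfold carrier_Aut_star_group carrier_Aut_group)
  fix k l assume kl: "k \<in> Aut_star M d" "l \<in> Aut_star M d"
  have "restrict (compose M k l) X = compose X (restrict k X) (restrict l X)"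
    using Aut_star_mem_X[OF kl(2)] X_subset by (auto simp: compose_def restrict_def)
  then show "restrict (k \<otimes>\<^bsub>Aut_star_group M d\<^esub> l) X
      = restrict k X \<otimes>\<^bsub>Aut_group X d\<^esub> restrict l X"
    using mult_Aut_star_group[OF kl] mult_Aut_group[OF kl[THEN restrict_Aut_star]] by simp
qed (rule restrict_Aut_star)

lemma subgroup_H: "subgroup H (Aut_group X d)"
proof -
  interpret group_hom "Aut_star_group M d" "Aut_group X d" "\<lambda>k. restrict k X"
    by (intro group_hom.intro group_hom_axioms.intro group_Aut_star_group group_Aut_group
        hom_restrict)
  have "H = (\<lambda>k. restrict k X) ` carrier (Aut_star_group M d)"
    by (auto simp: carrier_Aut_star_group)
  then show ?thesis
    using img_is_subgroup by simp
qed

lemma restrict_Aut_star_eqI: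
  assumes "k \<in> Aut_star M d" "l \<in> Aut_star M d" "x \<in> X" "k x = l x"
  shows "k = l"
  by (rule Aut_eqI[OF assms(1,2)[THEN Aut_star_Aut] X_subset[OF assms(3)] assms(4)])

lemma iso_restrict: "(\<lambda>k. restrict k X) \<in> iso (Aut_star_group M d) GH"
  unfolding iso_iff
proof (intro conjI)
  show "(\<lambda>k. restrict k X) \<in> hom (Aut_star_group M d) GH"
    using hom_restrict by (auto simp: hom_def Pi_iff carrier_Aut_star_group)
  show "(\<lambda>k. restrict k X) ` carrier (Aut_star_group M d) = carrier GH"
    by (auto simp: carrier_Aut_star_group)
  obtain x0 where x0: "x0 \<in> X"
    using obtain_sides by metis
  show "inj_on (\<lambda>k. restrict k X) (carrier (Aut_star_group M d))"
    unfolding carrier_Aut_star_group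
  proof (rule inj_onI)
    fix k l assume kl: "k \<in> Aut_star M d" "l \<in> Aut_star M d" "restrict k X = restrict l X"
    have "k x0 = l x0"
      using fun_cong[OF kl(3), of x0] x0 by simp
    then show "k = l"
      by (rule restrict_Aut_star_eqI[OF kl(1,2) x0])
  qed
qed

lemma comm_group_H: "comm_group GH"
proof -
  interpret GH: group GH
    by (rule group.subgroup_imp_group[OF group_Aut_group subgroup_H])
  show ?thesis
  proof (rule GH.group_comm_groupI)
    fix h k assume hk: "h \<in> carrier GH" "k \<in> carrier GH"
    then obtain h' k' where h': "h' \<in> Aut_star M d" "h = restrict h' X"
      and k': "k' \<in> Aut_star M d" "k = restrict k' X"
      by auto
    have "compose X h k = compose X k h"
      using Aut_star_commute[OF h'(1) k'(1) X_subset] Aut_star_mem_X[OF h'(1)]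
        Aut_star_mem_X[OF k'(1)]
      by (auto simp: compose_def h' k')
    then show "h \<otimes>\<^bsub>GH\<^esub> k = k \<otimes>\<^bsub>GH\<^esub> h"
      using hk H_Aut mult_Aut_group[of h X d k] mult_Aut_group[of k X d h] by simp
  qed
qed

lemma H_sharply_transitive:
  assumes x: "x \<in> X" and y: "y \<in> X"
  shows "\<exists>!h. h \<in> H \<and> h x = y"
proof -
  obtain g where g: "g \<in> Aut M d" "g x = y"
    using obtain_Aut x y X_subset by metis
  then have gS: "g \<in> Aut_star M d"
    using Aut_starI[of g x] x y X_subset by simp
  show ?thesis
  proof (rule ex1I)
    show "restrict g X \<in> H \<and> restrict g X x = y"
      using gS g x by auto
    fix h assume h: "h \<in> H \<and> h x = y"
    then obtain k where k: "k \<in> Aut_star M d" "h = restrict k X"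
      by blast
    then have "k = g"
      using restrict_Aut_star_eqI[OF k(1) gS x] h g x by simp
    then show "h = restrict g X"
      using k by simp
  qed
qed

lemma transporter_eq: "h \<in> H \<Longrightarrow> x \<in> X \<Longrightarrow> transporter H x (h x) = h"
  unfolding transporter_def
  using H_sharply_transitive[of x "h x"] H_Aut[of h] Aut_mem[of h X d x]
  by (intro the1_equality) auto

lemma one_homogeneous_X: "one_homogeneous X d"
  unfolding one_homogeneous_def
proof (intro ballI)
  fix x y assume "x \<in> X" "y \<in> X"
  from ex1_implies_ex[OF H_sharply_transitive[OF this]]
  obtain h where "h \<in> H" "h x = y"
    by (elim exE conjE)
  then show "\<exists>F\<in>Aut X d. F x = y"
    by (intro bexI[of _ h] H_Aut)
qed

end

section \<open>The rainbow duplicate\<close>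

context component_matching
begin

definition phi :: "'a \<times> nat \<Rightarrow> 'a"
  where "phi = (\<lambda>(x, i). (f ^^ i) x)"

abbreviation X2 :: "('a \<times> nat) set"
  where "X2 \<equiv> X \<times> {0, 1}"

abbreviation d2 :: "'a \<times> nat \<Rightarrow> 'a \<times> nat \<Rightarrow> real"
  where "d2 \<equiv> \<lambda>p p'. d (phi p) (phi p')"

lemma phi_simps: "phi (x, 0) = x" "phi (x, 1) = f x" "phi (x, Suc 0) = f x"
  by (simp_all add: phi_def)

lemma bij_phi: "bij_betw phi X2 M"
proof (rule bij_betwI')
  fix p p' assume "p \<in> X2" "p' \<in> X2"
  then obtain x i y j where "p = (x, i)" "p' = (y, j)" "x \<in> X" "y \<in> X" "i \<in> {0, 1}" "j \<in> {0, 1}"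
    by blast
  moreover from this have "x \<in> M" "y \<in> M" "f x \<notin> X" "f y \<notin> X"
    using X_subset f_side by auto
  ultimately show "phi p = phi p' \<longleftrightarrow> p = p'"
    by (auto simp: phi_simps f_inj)
next
  fix p assume "p \<in> X2"
  then show "phi p \<in> M"
    using X_subset f_mem by (auto simp: phi_simps)
next
  fix y assume y: "y \<in> M"
  show "\<exists>p\<in>X2. y = phi p"
  proof (cases "y \<in> X")
    case True
    then show ?thesis by (intro bexI[of _ "(y, 0)"]) (auto simp: phi_simps)
  next
    case False
    then show ?thesis
      using y f_side f_involution by (intro bexI[of _ "(f y, 1)"]) (auto simp: phi_simps)
  qed
qed

lemma phi_mem: "p \<in> X2 \<Longrightarrow> phi p \<in> M"
  using bij_phi by (auto simp: bij_betw_def)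

lemma isometry_phi: "isometry_betw X2 d2 M d phi"
  using bij_phi by (simp add: isometry_betw_def)

lemma Metric_space_X2: "Metric_space X2 d2"
proof
  show "d2 p p' = 0 \<longleftrightarrow> p = p'" if "p \<in> X2" "p' \<in> X2" for p p'
    using that phi_mem[OF that(1)] phi_mem[OF that(2)] bij_phi
    by (auto simp: bij_betw_def inj_on_eq_iff)
  show "d2 p p'' \<le> d2 p p' + d2 p' p''" if "p \<in> X2" "p' \<in> X2" "p'' \<in> X2" for p p' p''
    using that[THEN phi_mem] by (rule triangle)
qed (simp_all add: commute)

lemma d2_same: "x \<in> X \<Longrightarrow> y \<in> X \<Longrightarrow> i \<in> {0, 1} \<Longrightarrow> d2 (x, i) (y, i) = d x y"
  using f_isometry X_subset by (auto simp: phi_simps)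

text \<open>Components are transported back along \<open>phi\<close>; its preimage of \<open>X' = f ` X\<close> is the
  second copy of \<open>X\<close>.\<close>

lemma components_X2: "isosceles_components X2 d2 = {X \<times> {0}, X \<times> {1}}"
proof -
  have inj: "inj_on phi X2"
    using bij_phi by (simp add: bij_betw_def)
  have "phi ` (X \<times> {0}) = X"
    by (auto simp: phi_simps image_iff)
  then have 0: "inv_into X2 phi ` X = X \<times> {0}"
    using inv_into_image_cancel[OF inj, of "X \<times> {0}"] by auto
  have "phi ` (X \<times> {1}) = f ` X"
    by (force simp: phi_simps image_iff)
  then have 1: "inv_into X2 phi ` X' = X \<times> {1}"
    using inv_into_image_cancel[OF inj, of "X \<times> {1}"] by (auto simp: f_image)
  show ?thesis
    using isosceles_components_isometry[OF isometry_betw_inv_into[OF isometry_phi]] components 0 1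
    by simp
qed

lemma phi_Aut:
  assumes "k \<in> Aut M d" "x \<in> X" "i \<in> {0, 1}"
  shows "phi (k x, i) = k (phi (x, i))"
  using assms f_commute X_subset by (auto simp: phi_simps)

text \<open>Because \<open>f\<close> commutes with automorphisms, pulling \<open>k\<close> back along \<open>phi\<close> gives
  \<open>k|\<^sub>X \<times> id\<close>. So the map in question, preceded by restriction to \<open>X\<close>, is conjugation by the
  inverse of \<open>phi\<close>.\<close>

lemma iso_times_id: "(\<lambda>h. restrict (map_prod h id) X2) \<in> iso GH (Aut_star_group X2 d2)"
proof (rule iso_of_comp_iso[OF group_Aut_star_group iso_restrict])
  let ?c = "\<lambda>k. \<lambda>p\<in>X2. inv_into X2 phi (k (inv_into M (inv_into X2 phi) p))"
  show "?c \<in> iso (Aut_star_group M d) (Aut_star_group X2 d2)"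
    by (rule iso_Aut_star_conjugate[OF isometry_betw_inv_into[OF isometry_phi]])
  fix k assume "k \<in> carrier (Aut_star_group M d)"
  then have k: "k \<in> Aut_star M d"
    by (simp add: carrier_Aut_star_group)
  show "restrict (map_prod (restrict k X) id) X2 = ?c k"
  proof (rule restrict_ext)
    fix p assume p: "p \<in> X2"
    then obtain x i where xi: "p = (x, i)" "x \<in> X" "i \<in> {0, 1}"
      by blast
    have "inv_into M (inv_into X2 phi) p = phi p"
      using bij_phi p by (rule inv_into_inv_into_eq)
    then have "inv_into X2 phi (k (inv_into M (inv_into X2 phi) p)) = inv_into X2 phi (phi (k x, i))"
      using phi_Aut[OF Aut_star_Aut[OF k] xi(2,3)] xi(1) by simp
    also have "\<dots> = (k x, i)"
      using Aut_star_mem_X[OF k xi(2)] xi(3) by (intro bij_betw_inv_into_left[OF bij_phi]) simp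
    finally show "map_prod (restrict k X) id p = inv_into X2 phi (k (inv_into M (inv_into X2 phi) p))"
      using xi by simp
  qed
qed

text \<open>An element \<open>g\<close> of \<open>Aut\<^sub>*\<close> moving \<open>x\<close> to \<open>y\<close> commutes with \<open>h\<close>
  and with \<open>f\<close>, so it moves \<open>f (h x)\<close> to \<open>f (h y)\<close>.\<close>

lemma cross_distance_constant:
  assumes h: "h \<in> H" and x: "x \<in> X" and y: "y \<in> X"
  shows "d x (f (h x)) = d y (f (h y))"
proof -
  obtain k where k: "k \<in> Aut_star M d" "h = restrict k X"
    using h by blast
  obtain g where g: "g \<in> Aut M d" "g x = y"
    using obtain_Aut x y X_subset by metis
  then have gS: "g \<in> Aut_star M d"
    using Aut_starI[of g x] x y X_subset by simp
  have mem: "x \<in> M" "k x \<in> M" "f (k x) \<in> M"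
    using x X_subset Aut_mem[OF Aut_star_Aut[OF k(1)]] f_mem by simp_all
  have "f (k y) = f (g (k x))"
    using Aut_star_commute[OF k(1) gS mem(1)] g by simp
  also have "\<dots> = g (f (k x))"
    by (rule f_commute[OF g(1) mem(2)])
  finally show ?thesis
    using Aut_dist[OF g(1) mem(1,3)] g(2) x y k(2) by simp
qed

definition r :: "('a \<Rightarrow> 'a) \<Rightarrow> real"
  where "r h = (let x = SOME x. x \<in> X in d x (f (h x)))"

lemma r_eq:
  assumes "h \<in> H" "x \<in> X"
  shows "r h = d x (f (h x))"
  using cross_distance_constant[OF assms(1) _ assms(2)] someI[of "\<lambda>x. x \<in> X", OF assms(2)]
  by (simp add: r_def Let_def)

lemma H_mem: "h \<in> H \<Longrightarrow> x \<in> X \<Longrightarrow> h x \<in> X"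
  by (auto dest: Aut_star_mem_X)

lemma r_range: "r \<in> H \<rightarrow> {0<..} - Dist X d"
proof
  fix h assume h: "h \<in> H"
  obtain x where x: "x \<in> X" "x \<in> M"
    using obtain_sides by metis
  have hx: "h x \<in> M" "f (h x) \<in> M" "f (h x) \<notin> X"
    using H_mem[OF h x(1)] X_subset f_mem f_side by auto
  then have "f (h x) \<in> X'"
    using mem_X'_iff by blast
  then have "r h \<in> Dist M d - Dist X d"
    unfolding cross_distances_eq[symmetric] r_eq[OF h x(1)] using x by blast
  moreover have "0 < d x (f (h x))"
    using x hx nonneg[of x "f (h x)"] zero[of x "f (h x)"] by (metis less_eq_real_def)
  ultimately show "r h \<in> {0<..} - Dist X d"
    using r_eq[OF h x(1)] by simp
qed

text \<open>By rigidity the distance \<open>r h\<close> from \<open>x\<close> determines \<open>f (h x)\<close>, hence \<open>h x\<close>, hence \<open>h\<close>.\<close>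

lemma inj_r: "inj_on r H"
proof (rule inj_onI)
  fix h k assume h: "h \<in> H" and k: "k \<in> H" and eq: "r h = r k"
  obtain x where x: "x \<in> X" "x \<in> M"
    using obtain_sides by metis
  have hx: "h x \<in> X" "h x \<in> M" "k x \<in> X" "k x \<in> M"
    using H_mem[OF h x(1)] H_mem[OF k x(1)] X_subset by auto
  have "f (h x) = f (k x)"
  proof (rule cross_unique[OF x(2)])
    show "(x \<in> X) \<noteq> (f (k x) \<in> X)"
      using x hx f_side by simp
    show "d x (f (h x)) = d x (f (k x))"
      using eq r_eq[OF h x(1)] r_eq[OF k x(1)] by simp
  qed (use hx f_mem in auto)
  then have "h x = k x"
    using f_inj hx by simp
  then have "transporter H x (h x) = transporter H x (k x)"
    by (rule arg_cong)
  then show "h = k"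
    unfolding transporter_eq[OF h x(1)] transporter_eq[OF k x(1)] .
qed

lemma rainbow_dist_eq:
  assumes "p \<in> X2" "p' \<in> X2"
  shows "rainbow_dist X d H r p p' = d2 p p'"
proof -
  obtain x i y j where p: "p = (x, i)" "x \<in> X" "i \<in> {0, 1}" and p': "p' = (y, j)" "y \<in> X" "j \<in> {0, 1}"
    using assms by blast
  have cross: "r (transporter H u v) = d u (f v)" if uv: "u \<in> X" "v \<in> X" for u v
  proof -
    obtain h where h: "h \<in> H" "h u = v"
      using ex1_implies_ex[OF H_sharply_transitive[OF uv]] by (elim exE conjE)
    then show ?thesis
      using transporter_eq[OF h(1) uv(1)] r_eq[OF h(1) uv(1)] by simp
  qed
  show ?thesis
    using p p' cross d2_same[of x y 0] d2_same[of x y 1]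
    by (auto simp: rainbow_dist_def phi_simps commute[of "f x"])
qed

text \<open>No automorphism of the whole space that exchanges the components acts on \<open>X\<close>, but
  composing one with the matching \<open>f\<close> brings it back to \<open>X\<close>. As \<open>f\<close> is an involution commuting
  with all automorphisms, the composite still is an involution that inverts \<open>H\<close>.\<close>

lemma ex_inverter:
  "\<exists>g\<in>Aut X d. g \<otimes>\<^bsub>Aut_group X d\<^esub> g = \<one>\<^bsub>Aut_group X d\<^esub> \<and>
     (\<forall>h\<in>H. g \<otimes>\<^bsub>Aut_group X d\<^esub> h \<otimes>\<^bsub>Aut_group X d\<^esub> inv\<^bsub>Aut_group X d\<^esub> g
        = inv\<^bsub>Aut_group X d\<^esub> h)"
proof -
  interpret A: group "Aut_group X d" by (rule group_Aut_group)
  obtain s where s: "s \<in> Aut M d" and side: "\<And>x. x \<in> M \<Longrightarrow> s x \<in> X \<longleftrightarrow> x \<notin> X"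
    and invol: "\<And>x. x \<in> M \<Longrightarrow> s (s x) = x"
    using obtain_swap by metis
  define g where "g = (\<lambda>x\<in>X. f (s x))"
  have sM: "s x \<in> M" if "x \<in> M" for x
    using s that by (rule Aut_mem)
  have g_mem: "f (s x) \<in> X" if "x \<in> X" for x
    using that side sM X_subset f_side by simp
  have gg: "f (s (f (s x))) = x" if "x \<in> M" for x
    using that f_commute[OF s] sM f_mem f_involution invol by simp
  have bij: "bij_betw g X X"
    by (rule bij_betw_byWitness[where f' = g]) (use g_mem gg X_subset in \<open>auto simp: g_def\<close>)
  have dist: "d (f (s x)) (f (s y)) = d x y" if "x \<in> X" "y \<in> X" for x y
    using that X_subset side sM by (simp add: f_isometry Aut_dist[OF s])
  have g: "g \<in> Aut X d"
    using bij dist by (simp add: Aut_iff g_def)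
  have "compose X g g = (\<lambda>x\<in>X. x)"
    using g_mem gg X_subset by (auto simp: compose_def g_def)
  then have square: "g \<otimes>\<^bsub>Aut_group X d\<^esub> g = \<one>\<^bsub>Aut_group X d\<^esub>"
    by (simp add: mult_Aut_group[OF g g] one_Aut_group)
  then have inv_g: "inv\<^bsub>Aut_group X d\<^esub> g = g"
    using g by (intro A.inv_equality) (simp_all add: carrier_Aut_group)
  show ?thesis
  proof (intro bexI[OF _ g] conjI ballI square)
    fix h assume h: "h \<in> H"
    then obtain k where k: "k \<in> Aut_star M d" "h = restrict k X"
      by blast
    have hA: "h \<in> Aut X d"
      using h by (rule H_Aut)
    have "f (s (k (f (s (k x))))) = x" if x: "x \<in> X" for x
    proof -
      have mem: "x \<in> M" "k x \<in> M" "s (k x) \<in> M" "k (s (k x)) \<in> M"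
        using x X_subset sM Aut_mem[OF Aut_star_Aut[OF k(1)]] by auto
      have "k (f (s (k x))) = f (k (s (k x)))"
        using f_commute[OF Aut_star_Aut[OF k(1)] mem(3)] by simp
      also have "k (s (k x)) = s x"
        using swap_inverts_Aut_star[OF s mem(1) _ k(1) mem(1)] side[OF mem(1)] by blast
      finally show ?thesis
        using gg[OF mem(1)] f_commute[OF s] sM f_mem mem(1) by simp
    qed
    then have "compose X (compose X g h) (compose X g h) = (\<lambda>x\<in>X. x)"
      using g_mem Aut_star_mem_X[OF k(1)] by (auto simp: compose_def g_def k(2))
    then have "(g \<otimes>\<^bsub>Aut_group X d\<^esub> h) \<otimes>\<^bsub>Aut_group X d\<^esub> (g \<otimes>\<^bsub>Aut_group X d\<^esub> h)
        = \<one>\<^bsub>Aut_group X d\<^esub>"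
      using mult_Aut_group[OF g hA] mult_Aut_group[of "compose X g h" X d "compose X g h"]
        Aut_compose[OF g hA]
      by (simp add: one_Aut_group)
    then have "inv\<^bsub>Aut_group X d\<^esub> h = (g \<otimes>\<^bsub>Aut_group X d\<^esub> h) \<otimes>\<^bsub>Aut_group X d\<^esub> g"
      using g hA unfolding carrier_Aut_group[of X d, symmetric]
      by (intro A.inv_equality) (simp_all add: A.m_assoc)
    then show "g \<otimes>\<^bsub>Aut_group X d\<^esub> h \<otimes>\<^bsub>Aut_group X d\<^esub> inv\<^bsub>Aut_group X d\<^esub> g
        = inv\<^bsub>Aut_group X d\<^esub> h"
      using inv_g by simp
  qed
qed

lemma rainbow_admissible_r: "rainbow_admissible X d H r"
  unfolding rainbow_admissible_def
proof (intro conjI)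
  show "Metric_space X d"
    by (rule subspace) (use X_subset in blast)
  show "\<forall>p\<in>X2. \<forall>p'\<in>X2. \<forall>p''\<in>X2.
      rainbow_dist X d H r p p'' \<le> rainbow_dist X d H r p p' + rainbow_dist X d H r p' p''"
  proof (intro ballI)
    fix p p' p'' assume p: "p \<in> X2" "p' \<in> X2" "p'' \<in> X2"
    show "rainbow_dist X d H r p p'' \<le> rainbow_dist X d H r p p' + rainbow_dist X d H r p' p''"
      unfolding rainbow_dist_eq[OF p(1,3)] rainbow_dist_eq[OF p(1,2)] rainbow_dist_eq[OF p(2,3)]
      by (rule Metric_space.triangle[OF Metric_space_X2 p])
  qed
  show "\<forall>x\<in>X. \<forall>y\<in>X. \<exists>!h. h \<in> H \<and> h x = y"
    by (intro ballI H_sharply_transitive)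
qed (fact one_homogeneous_X subgroup_H comm_group_H ex_inverter r_range inj_r)+

lemma isometry_rainbow: "isometry_betw X2 (rainbow_dist X d H r) M d phi"
  unfolding isometry_betw_def
  by (intro conjI bij_phi ballI) (rule rainbow_dist_eq[symmetric])

end

theorem proposition5p18:
  fixes M :: "'a set" and d :: "'a \<Rightarrow> 'a \<Rightarrow> real" and X X' :: "'a set"
  assumes "Metric_space M d"
    and "one_homogeneous M d"
    and "isosceles_components M d = {X, X'}"
    and "X \<noteq> X'"
  shows
    "(\<exists>H r \<psi>. rainbow_admissible X d H r \<and>
        isometry_betw (X \<times> {0, 1}) (rainbow_dist X d H r) M d \<psi>)
   \<and> {d x x' |x x'. x \<in> X \<and> x' \<in> X'} = Dist M d - Dist X d
   \<and> (\<forall>q \<in> Dist M d - Dist X d.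
        (\<exists>!f. f \<in> M \<rightarrow>\<^sub>E M \<and> (\<forall>y\<in>M. d y (f y) = q))
      \<and> (\<forall>f. f \<in> M \<rightarrow>\<^sub>E M \<and> (\<forall>y\<in>M. d y (f y) = q) \<longrightarrow>
          compose M f f = (\<lambda>y\<in>M. y)
        \<and> f ` X = X' \<and> f ` X' = X
        \<and> isometry_betw X d X' d (restrict f X)
        \<and> (\<forall>g\<in>Aut M d. compose M f g = compose M g f)
        \<and> (let \<phi> = (\<lambda>(x, i). (f ^^ i) x);
               X2 = X \<times> {0, 1::nat};
               d2 = (\<lambda>p p'. d (\<phi> p) (\<phi> p'));
               H = {restrict h X |h. h \<in> Aut_star M d};
               GH = (Aut_group X d)\<lparr>carrier := H\<rparr>
           in
             bij_betw \<phi> X2 M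
           \<and> Metric_space X2 d2
           \<and> isometry_betw X2 d2 M d \<phi>
           \<and> (\<forall>x\<in>X. \<forall>y\<in>X. \<forall>i\<in>{0, 1}. d2 (x, i) (y, i) = d x y)

           \<and> subgroup H (Aut_group X d)
           \<and> isosceles_components X2 d2 = {X \<times> {0}, X \<times> {1}}
           \<and> (\<lambda>h. restrict (map_prod h id) X2) \<in> iso GH (Aut_star_group X2 d2)
           \<and> (\<lambda>k. \<lambda>y\<in>M. \<phi> (k (inv_into X2 \<phi> y)))
                \<in> iso (Aut_star_group X2 d2) (Aut_star_group M d)
           \<and> comm_group GH
           \<and> (\<forall>x\<in>X. \<forall>y\<in>X. \<exists>!h. h \<in> H \<and> h x = y)

           \<and> (\<forall>h\<in>H. \<forall>x\<in>X. \<forall>y\<in>X. d2 (x, 0) (h x, 1) = d2 (y, 0) (h y, 1))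
           \<and> (\<exists>r. (\<forall>h\<in>H. \<forall>x\<in>X. r h = d2 (x, 0) (h x, 1))
                \<and> r \<in> H \<rightarrow> {0<..} - Dist X d
                \<and> inj_on r H

                \<and> rainbow_admissible X d H r
                \<and> isometry_betw X2 (rainbow_dist X d H r) M d \<phi>))))"
proof -
  interpret two_components M d X X'
    using assms by (intro two_components.intro two_components_axioms.intro)
  have matching: "component_matching M d X X' f q"
    if "q \<in> Dist M d - Dist X d" "f \<in> M \<rightarrow>\<^sub>E M \<and> (\<forall>y\<in>M. d y (f y) = q)" for f q
    using that two_components_axioms
    by (auto intro!: component_matching.intro component_matching_axioms.intro)
  show ?thesis
  proof (intro conjI ballI allI impI)
    obtain x0 x1 where "x0 \<in> X" "x1 \<in> X'"
      using obtain_sides mem_X'_iff by metis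
    then have "d x0 x1 \<in> Dist M d - Dist X d"
      using cross_distances_eq by blast
    moreover from ex1_matching[OF this]
    obtain f where "f \<in> M \<rightarrow>\<^sub>E M \<and> (\<forall>y\<in>M. d y (f y) = d x0 x1)"
      by blast
    ultimately interpret component_matching M d X X' f "d x0 x1"
      by (rule matching)
    show "\<exists>H r \<psi>. rainbow_admissible X d H r \<and>
        isometry_betw (X \<times> {0, 1}) (rainbow_dist X d H r) M d \<psi>"
      using rainbow_admissible_r isometry_rainbow by blast
    show "{d x x' |x x'. x \<in> X \<and> x' \<in> X'} = Dist M d - Dist X d"
      by (rule cross_distances_eq)
  next
    fix q assume "q \<in> Dist M d - Dist X d"
    then show "\<exists>!f. f \<in> M \<rightarrow>\<^sub>E M \<and> (\<forall>y\<in>M. d y (f y) = q)"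
      by (rule ex1_matching)
  next
    fix q f
    assume "q \<in> Dist M d - Dist X d" "f \<in> M \<rightarrow>\<^sub>E M \<and> (\<forall>y\<in>M. d y (f y) = q)"
    then interpret component_matching M d X X' f q
      by (rule matching)
    show "compose M f f = (\<lambda>y\<in>M. y)"
      using f_involution by (auto simp: compose_def)
    show "f ` X = X'" "f ` X' = X" "isometry_betw X d X' d (restrict f X)"
      by (fact f_image isometry_betw_f)+
    show "compose M f g = compose M g f" if "g \<in> Aut M d" for g
      using f_commute[OF that] by (auto simp: compose_def)
    have r: "\<exists>r. (\<forall>h\<in>H. \<forall>x\<in>X. r h = d2 (x, 0) (h x, 1))
        \<and> r \<in> H \<rightarrow> {0<..} - Dist X d \<and> inj_on r H
        \<and> rainbow_admissible X d H r \<and> isometry_betw X2 (rainbow_dist X d H r) M d phi"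
      using r_eq r_range inj_r rainbow_admissible_r isometry_rainbow
      by (intro exI[of _ r] conjI ballI) (simp_all only: phi_simps)
    have const: "\<forall>h\<in>H. \<forall>x\<in>X. \<forall>y\<in>X. d2 (x, 0) (h x, 1) = d2 (y, 0) (h y, 1)"
      unfolding phi_simps using cross_distance_constant by blast
    have same: "\<forall>x\<in>X. \<forall>y\<in>X. \<forall>i\<in>{0, 1}. d2 (x, i) (y, i) = d x y"
      using d2_same by blast
    have transitive: "\<forall>x\<in>X. \<forall>y\<in>X. \<exists>!h. h \<in> H \<and> h x = y"
      by (intro ballI H_sharply_transitive)
    note facts = bij_phi Metric_space_X2 isometry_phi same subgroup_H components_X2 iso_times_id
      iso_Aut_star_conjugate[OF isometry_phi] comm_group_H transitive const r
    show "let \<phi> = (\<lambda>(x, i). (f ^^ i) x);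
               X2 = X \<times> {0, 1::nat};
               d2 = (\<lambda>p p'. d (\<phi> p) (\<phi> p'));
               H = {restrict h X |h. h \<in> Aut_star M d};
               GH = (Aut_group X d)\<lparr>carrier := H\<rparr>
           in
             bij_betw \<phi> X2 M
           \<and> Metric_space X2 d2
           \<and> isometry_betw X2 d2 M d \<phi>
           \<and> (\<forall>x\<in>X. \<forall>y\<in>X. \<forall>i\<in>{0, 1}. d2 (x, i) (y, i) = d x y)
           \<and> subgroup H (Aut_group X d)
           \<and> isosceles_components X2 d2 = {X \<times> {0}, X \<times> {1}}
           \<and> (\<lambda>h. restrict (map_prod h id) X2) \<in> iso GH (Aut_star_group X2 d2)
           \<and> (\<lambda>k. \<lambda>y\<in>M. \<phi> (k (inv_into X2 \<phi> y)))
                \<in> iso (Aut_star_group X2 d2) (Aut_star_group M d)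
           \<and> comm_group GH
           \<and> (\<forall>x\<in>X. \<forall>y\<in>X. \<exists>!h. h \<in> H \<and> h x = y)
           \<and> (\<forall>h\<in>H. \<forall>x\<in>X. \<forall>y\<in>X. d2 (x, 0) (h x, 1) = d2 (y, 0) (h y, 1))
           \<and> (\<exists>r. (\<forall>h\<in>H. \<forall>x\<in>X. r h = d2 (x, 0) (h x, 1))
                \<and> r \<in> H \<rightarrow> {0<..} - Dist X d
                \<and> inj_on r H
                \<and> rainbow_admissible X d H r
                \<and> isometry_betw X2 (rainbow_dist X d H r) M d \<phi>)"
      unfolding Let_def phi_def[symmetric]
      by (intro conjI; fact facts)
  qed
qed

end
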